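(* The set $\mathcal{C}_{\mathcal{Q}}$ is dense in $(\mathcal{C},d_\infty)$, where $\mathcal{C}_{\mathcal{Q}}$ is the family of all bivariate copulas $C$ for which there exists a Borel set $\Lambda\subseteq[0,1]$ with $\lambda(\Lambda)=1$ such that for every $x\in\Lambda$ there exists a dense set $\mathcal{Q}_x\subset[0,1]$ such that the partial derivative $\partial_1C(x,y)$ does not exist for any $y\in\mathcal{Q}_x$.
   Context: $\lambda$ is Lebesgue measure on $[0,1]$. $\mathcal{C}$ is the family of all bivariate copulas (restrictions to $[0,1]^2$ of bivariate distribution functions with uniform marginals on $[0,1]$), and $d_\infty(A,B)=\sup_{(x,y)\in[0,1]^2}|A(x,y)-B(x,y)|$ is the uniform metric on $\mathcal{C}$. $\partial_1C$ is the partial derivative of $C$ with respect to its first argument. *)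

theory Defs
  imports "HOL-Probability.Probability"
begin

definition unit_square :: "(real \<times> real) set" where
  "unit_square = {0..1} \<times> {0..1}"

definition bivariate_cdf :: "(real \<times> real) measure \<Rightarrow> real \<times> real \<Rightarrow> real" where
  "bivariate_cdf M = (\<lambda>(x, y). measure M ({..x} \<times> {..y}))"

definition uniform_marginals :: "(real \<times> real) measure \<Rightarrow> bool" where
  "uniform_marginals M \<longleftrightarrow>
     distr M borel fst = uniform_measure lborel {0..1} \<and>
     distr M borel snd = uniform_measure lborel {0..1}"

text \<open>
  Copulas are extensional functions (equal to \<^term>\<open>undefined\<close> off the unit square), so that
  two copulas agreeing on the unit square are equal and the uniform distance separates points.
\<close>

definition copulas :: "(real \<times> real \<Rightarrow> real) set" where
  "copulas = {restrict (bivariate_cdf M) unit_square | M.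
     prob_space M \<and> sets M = sets borel \<and> uniform_marginals M}"

text \<open>
  The locale \<^locale>\<open>Metric_space\<close> asks for a distance that is nonnegative on the whole type,
  whereas the supremum is unspecified for unbounded differences; hence the value 0 outside
  \<^const>\<open>copulas\<close>.
\<close>

definition d_inf :: "(real \<times> real \<Rightarrow> real) \<Rightarrow> (real \<times> real \<Rightarrow> real) \<Rightarrow> real" where
  "d_inf A B = (if A \<in> copulas \<and> B \<in> copulas then SUP p\<in>unit_square. \<bar>A p - B p\<bar> else 0)"

text \<open>
  The derivative is taken within the domain \<open>[0,1]\<close> of the first argument: this is the usual
  derivative for \<open>0 < x < 1\<close> and the one-sided derivative at the two endpoints.
\<close>

definition has_partial1 :: "(real \<times> real \<Rightarrow> real) \<Rightarrow> real \<Rightarrow> real \<times> real \<Rightarrow> bool" where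
  "has_partial1 C D = (\<lambda>(x, y).
     ((\<lambda>t. C (t, y)) has_real_derivative D) (at x within {0..1}))"

definition copulas_Q :: "(real \<times> real \<Rightarrow> real) set" where
  "copulas_Q = {C \<in> copulas.
     \<exists>\<Lambda>. \<Lambda> \<in> sets borel \<and> \<Lambda> \<subseteq> {0..1} \<and> emeasure lborel \<Lambda> = 1 \<and>
       (\<forall>x\<in>\<Lambda>. \<exists>Q. Q \<subseteq> {0..1} \<and> {0..1} \<subseteq> closure Q \<and>
          (\<forall>y\<in>Q. \<nexists>D. has_partial1 C D (x, y)))}"

lemma copula_bounds:
  assumes "C \<in> copulas" "p \<in> unit_square"
  shows "0 \<le> C p" "C p \<le> 1"
  using assms
  by (auto simp: copulas_def bivariate_cdf_def prob_space.prob_le_1 split: prod.splits)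

lemma copula_extensional: "C \<in> copulas \<Longrightarrow> C \<in> extensional unit_square"
  by (auto simp: copulas_def)

lemma abs_diff_copula_le_1:
  assumes "A \<in> copulas" "B \<in> copulas" "p \<in> unit_square"
  shows "\<bar>A p - B p\<bar> \<le> 1"
  using copula_bounds[OF assms(1,3)] copula_bounds[OF assms(2,3)] by linarith

lemma abs_diff_le_d_inf:
  assumes "A \<in> copulas" "B \<in> copulas" "p \<in> unit_square"
  shows "\<bar>A p - B p\<bar> \<le> d_inf A B"
proof -
  have "bdd_above ((\<lambda>p. \<bar>A p - B p\<bar>) ` unit_square)"
    by (rule bdd_aboveI2[where M = 1]) (rule abs_diff_copula_le_1[OF assms(1,2)])
  then have "\<bar>A p - B p\<bar> \<le> (SUP p\<in>unit_square. \<bar>A p - B p\<bar>)"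
    by (rule cSUP_upper[OF assms(3)])
  then show ?thesis
    using assms by (simp add: d_inf_def)
qed

lemma d_inf_least:
  assumes "A \<in> copulas" "B \<in> copulas" "\<And>p. p \<in> unit_square \<Longrightarrow> \<bar>A p - B p\<bar> \<le> e"
  shows "d_inf A B \<le> e"
proof -
  have "unit_square \<noteq> {}"
    by (auto simp: unit_square_def)
  then have "(SUP p\<in>unit_square. \<bar>A p - B p\<bar>) \<le> e"
    by (rule cSUP_least) (rule assms(3))
  then show ?thesis
    using assms(1,2) by (simp add: d_inf_def)
qed

lemma Metric_space_copulas: "Metric_space copulas d_inf"
proof
  have z: "(0, 0) \<in> unit_square"
    by (simp add: unit_square_def)
  show nonneg: "0 \<le> d_inf A B" for A B
  proof (cases "A \<in> copulas \<and> B \<in> copulas")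
    case True
    then show ?thesis
      using abs_diff_le_d_inf[OF _ _ z, of A B] by linarith
  next
    case False
    then show ?thesis
      by (simp only: d_inf_def if_False order_refl)
  qed
  show "d_inf A B = d_inf B A" for A B
    by (auto simp: d_inf_def abs_minus_commute)
  show "d_inf A B = 0 \<longleftrightarrow> A = B" if "A \<in> copulas" "B \<in> copulas" for A B
  proof
    assume "d_inf A B = 0"
    then have "A p = B p" if "p \<in> unit_square" for p
      using abs_diff_le_d_inf[OF \<open>A \<in> copulas\<close> \<open>B \<in> copulas\<close> that] by simp
    then show "A = B"
      using that copula_extensional by (blast intro: extensionalityI)
  next
    assume "A = B"
    have "d_inf B B \<le> 0"
      by (rule d_inf_least) (simp_all add: that(2))
    then show "d_inf A B = 0"
      using \<open>A = B\<close> nonneg[of B B] by simp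
  qed
  show "d_inf A C \<le> d_inf A B + d_inf B C"
    if "A \<in> copulas" "B \<in> copulas" "C \<in> copulas" for A B C
  proof (rule d_inf_least[OF that(1,3)])
    fix p assume "p \<in> unit_square"
    then show "\<bar>A p - C p\<bar> \<le> d_inf A B + d_inf B C"
      using abs_diff_le_d_inf[OF that(1,2)] abs_diff_le_d_inf[OF that(2,3)]
      by (smt (verit))
  qed
qed

end

theory Submission
  imports Defs
begin

text \<open>
  A mixture of copulas is again a copula, so it suffices to mix a small portion of one irregular
  copula \<open>K\<close> into an approximation \<open>A\<close> of the given copula, provided that \<open>\<partial>\<^sub>1A(x,y)\<close> exists for
  irrational \<open>x\<close> and all \<open>y\<close>.

  If \<open>(X,Y)\<close> has the given copula as distribution function and \<open>U\<close> is an independent uniform variable,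
  then \<open>A\<close> is the copula of \<open>((\<lfloor>NX\<rfloor> + U)/N, Y)\<close>: it is within \<open>1/N\<close> of the given copula and affine in
  the first argument on each interval \<open>[k/N, (k+1)/N)\<close>.

  \<open>K\<close> is the copula of \<open>(X, frac (X + Z))\<close>, where \<open>Z\<close> is independent of \<open>X\<close> and charges every rational
  number. For irrational \<open>x\<close>, the second difference quotient \<open>(K(x+h,y) + K(x-h,y) - 2K(x,y))/h\<close> tends
  to \<open>-P(frac (x + Z) = y)\<close> as \<open>h\<close> decreases to \<open>0\<close>, whereas it would tend to \<open>0\<close> if
  \<open>\<partial>\<^sub>1K(x,y)\<close> existed. The limit is negative on the dense set of all \<open>y\<close> in \<open>(0,1)\<close> with
  \<open>y - x\<close> rational.
\<close>

subsection \<open>Measures with uniform marginals\<close>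

abbreviation uniform01 :: "real measure" where
  "uniform01 \<equiv> uniform_measure lborel {0..1}"

definition copula_measure :: "(real \<times> real) measure \<Rightarrow> bool" where
  "copula_measure M \<longleftrightarrow> prob_space M \<and> sets M = sets borel \<and> uniform_marginals M"

lemma copula_measure_prob_space: "copula_measure M \<Longrightarrow> prob_space M"
  and copula_measure_sets: "copula_measure M \<Longrightarrow> sets M = sets borel"
  by (simp_all add: copula_measure_def)

lemma copulas_eq: "copulas = {restrict (bivariate_cdf M) unit_square | M. copula_measure M}"
  by (simp add: copulas_def copula_measure_def)

lemma prob_space_uniform01: "prob_space uniform01"
  by (rule prob_space_uniform_measure) auto

lemma measure_uniform01:
  assumes "A \<in> sets borel"
  shows "measure uniform01 A = measure lborel ({0..1} \<inter> A)"
  using assms by (subst measure_uniform_measure) auto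

lemma measure_uniform01_atMost: "0 \<le> x \<Longrightarrow> x \<le> 1 \<Longrightarrow> measure uniform01 {..x} = x"
proof -
  assume "0 \<le> x" "x \<le> 1"
  then have "{0..1} \<inter> {..x} = {0..x}" by auto
  then show ?thesis using \<open>0 \<le> x\<close> by (simp add: measure_uniform01)
qed

lemma measure_uniform01_le:
  assumes "A \<in> sets borel" "A \<subseteq> {u..v}" "u \<le> v"
  shows "measure uniform01 A \<le> v - u"
proof -
  have "measure lborel ({0..1} \<inter> A) \<le> measure lborel {u..v}"
    using assms by (intro measure_mono_fmeasurable) (auto simp: fmeasurable_def)
  then show ?thesis using assms by (simp add: measure_uniform01)
qed

text \<open>Monotonicity and the values at 0 and 1 fix the distribution function outside the unit
  interval as well, and a distribution function determines its measure.\<close>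

lemma uniform01_eqI:
  assumes N: "prob_space N" "sets N = sets borel"
    and cdf: "\<And>x. 0 \<le> x \<Longrightarrow> x \<le> 1 \<Longrightarrow> measure N {..x} = x"
  shows "N = uniform01"
proof (rule cdf_unique)
  have *: "real_distribution L" if "prob_space L" "sets L = sets borel" for L :: "real measure"
    using that sets_eq_imp_space_eq[OF that(2)]
    by (simp add: real_distribution_def real_distribution_axioms_def)
  show "real_distribution N" using N by (rule *)
  show "real_distribution uniform01" by (rule *) (simp_all add: prob_space_uniform01)
  have ext: "measure L {..x} = (if x < 0 then 0 else if x \<le> 1 then x else 1)"
    if L: "prob_space L" "sets L = sets borel" "\<And>x. 0 \<le> x \<Longrightarrow> x \<le> 1 \<Longrightarrow> measure L {..x} = x"
    for L :: "real measure" and x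
  proof -
    interpret prob_space L by (rule L)
    have "measure L {..x} \<le> measure L {..0}" if "x < 0"
      using that L(2) by (intro finite_measure_mono) auto
    moreover have "measure L {..1} \<le> measure L {..x}" if "x > 1"
      using that L(2) by (intro finite_measure_mono) auto
    ultimately show ?thesis using L(3)[of 0] L(3)[of 1] L(3)[of x] prob_le_1[of "{..x}"]
        measure_nonneg[of L "{..x}"] by force
  qed
  show "cdf N = cdf uniform01"
    using ext[OF N cdf] ext[OF prob_space_uniform01 _ measure_uniform01_atMost]
    by (simp add: fun_eq_iff cdf_def)
qed

section \<open>Invariance of the uniform law under rotations of the circle\<close>

lemma borel_measurable_frac [measurable]: "(frac :: real \<Rightarrow> real) \<in> borel_measurable borel"
  unfolding frac_def[abs_def] by measurable

text \<open>Up to a null set the event is an interval of length \<open>y\<close>, cut into two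
  pieces by the wrap-around exactly when \<open>r \<le> y\<close>.\<close>

lemma measure_uniform01_frac_le:
  assumes y: "0 \<le> y" "y \<le> 1"
  shows "measure uniform01 {s. frac (s + a) \<le> y} = y"
proof -
  define r where "r = frac a"
  have r: "0 \<le> r" "r < 1" by (auto simp: r_def frac_lt_1)
  have fr: "frac (s + a) = (if s + r < 1 then s + r else s + r - 1)" if "0 \<le> s" "s < 1" for s
  proof -
    have "frac s = s" using that by (simp add: frac_eq)
    then show ?thesis by (simp add: frac_add r_def)
  qed
  have ms: "{s. frac (s + a) \<le> y} \<in> sets borel" by measurable
  show ?thesis
  proof (cases "y = 1")
    case True
    then have "{s. frac (s + a) \<le> y} = UNIV"
      using frac_lt_1 by (auto intro: less_imp_le)
    then show ?thesis using True by (simp add: measure_uniform01)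
  next
    case False
    have N: "AE s in lborel. s \<noteq> (1::real)" by (rule AE_lborel_singleton)
    show ?thesis
    proof (cases "r \<le> y")
      case True
      have "measure lborel ({0..1} \<inter> {s. frac (s + a) \<le> y})
        = measure lborel ({0..y - r} \<union> {1 - r<..1})"
      proof (rule measure_eq_AE)
        show "AE s in lborel. s \<in> {0..1} \<inter> {s. frac (s + a) \<le> y} \<longleftrightarrow>
           s \<in> {0..y - r} \<union> {1 - r<..1}"
          \<comment> \<open>The point \<open>1 - r\<close> is rotated to 0, so it lies in the event
            but not in the two intervals; \<open>fr\<close> says nothing about
            \<open>s = 1\<close>.\<close>
          using N AE_lborel_singleton[of "1 - r"]
        proof eventually_elim
          case (elim s)
          then show ?case using fr[of s] y r False True by (auto split: if_splits)
        qed
      qed (use ms in auto)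
      also have "\<dots> = measure lborel {0..y - r} + measure lborel {1 - r<..1}"
        using r y False True by (intro measure_Union) auto
      also have "\<dots> = y" using r True by simp
      finally show ?thesis by (simp add: measure_uniform01 ms)
    next
      case rl: False
      have "measure lborel ({0..1} \<inter> {s. frac (s + a) \<le> y}) = measure lborel {1 - r..y + 1 - r}"
      proof (rule measure_eq_AE)
        show "AE s in lborel. s \<in> {0..1} \<inter> {s. frac (s + a) \<le> y} \<longleftrightarrow> s \<in> {1 - r..y + 1 - r}"
          using N
        proof eventually_elim
          case (elim s)
          then show ?case using fr[of s] y r rl by (auto split: if_splits)
        qed
      qed (use ms in auto)
      also have "\<dots> = y" using y by simp
      finally show ?thesis by (simp add: measure_uniform01 ms)
    qed
  qed
qed

section \<open>Mixtures and vertical strips\<close>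

lemma borel_measurable_fst_snd_real [measurable]:
  "(fst :: real \<times> real \<Rightarrow> real) \<in> borel_measurable borel"
  "(snd :: real \<times> real \<Rightarrow> real) \<in> borel_measurable borel"
  by (intro borel_measurable_continuous_onI continuous_intros)+

text \<open>Taking marginals commutes with mixing, and mixing copies of one law returns that law.
  The index law is discrete so that measurability of the family \<open>f\<close> is
  automatic.\<close>

lemma copula_measure_bind:
  fixes p :: "'i pmf"
  assumes f: "\<And>i. copula_measure (f i)"
  shows "copula_measure (measure_pmf p \<bind> f)"
    and "bivariate_cdf (measure_pmf p \<bind> f) z = (\<integral>i. bivariate_cdf (f i) z \<partial>measure_pmf p)"
proof -
  have meas: "f \<in> measurable (measure_pmf p) (subprob_algebra borel)"
    using f by (auto simp: space_subprob_algebra copula_measure_def prob_space_imp_subprob_space)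
  have "prob_space (measure_pmf p \<bind> f)"
    using f by (intro measure_pmf.prob_space_bind[OF _ meas]) (auto simp: copula_measure_def)
  moreover have "sets (measure_pmf p \<bind> f) = sets borel"
    using f by (intro sets_bind) (auto simp: copula_measure_def)
  moreover have "distr (measure_pmf p \<bind> f) borel g = uniform01"
    if "g \<in> measurable borel borel" "\<And>i. distr (f i) borel g = uniform01" for g
    using that prob_space_uniform01
    by (subst distr_bind[OF meas])
       (auto simp: bind_const' measure_pmf.prob_space_axioms prob_space_imp_subprob_space)
  ultimately show "copula_measure (measure_pmf p \<bind> f)"
    using f by (auto simp: copula_measure_def uniform_marginals_def)
  show "bivariate_cdf (measure_pmf p \<bind> f) z = (\<integral>i. bivariate_cdf (f i) z \<partial>measure_pmf p)"
    unfolding bivariate_cdf_def split_def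
    by (rule measure_pmf.measure_bind[OF meas]) (auto intro!: borel_Times)
qed

lemma copula_measure_mix:
  assumes "copula_measure M" "copula_measure N" "0 \<le> d" "d \<le> 1"
  obtains L where "copula_measure L"
    "\<And>z. bivariate_cdf L z = d * bivariate_cdf M z + (1 - d) * bivariate_cdf N z"
proof
  let ?f = "\<lambda>b. if b then M else N"
  show "copula_measure (measure_pmf (bernoulli_pmf d) \<bind> ?f)"
    using assms by (intro copula_measure_bind) auto
  show "bivariate_cdf (measure_pmf (bernoulli_pmf d) \<bind> ?f) z
      = d * bivariate_cdf M z + (1 - d) * bivariate_cdf N z" for z
    using assms by (subst copula_measure_bind) auto
qed

lemma copula_measure_strip:
  assumes M: "copula_measure M" and A: "A \<in> sets borel"
  shows "measure M (A \<times> UNIV) = measure uniform01 A"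
proof -
  have s: "sets M = sets borel" using M by (simp add: copula_measure_def)
  have "distr M borel fst = uniform01" using M by (simp add: copula_measure_def uniform_marginals_def)
  then have "measure uniform01 A = measure (distr M borel fst) A" by simp
  also have "\<dots> = measure M (fst -` A \<inter> space M)"
    using A s by (intro measure_distr) (simp_all cong: measurable_cong_sets)
  also have "fst -` A \<inter> space M = A \<times> UNIV"
    using sets_eq_imp_space_eq[OF s] by auto
  finally show ?thesis by simp
qed

subsection \<open>Smoothing along the first coordinate\<close>

lemma measure_pair_Times:
  assumes "prob_space M" "prob_space N" "A \<in> sets M" "B \<in> sets N"
  shows "measure (M \<Otimes>\<^sub>M N) (A \<times> B) = measure M A * measure N B"
proof -
  interpret N: prob_space N by fact
  show ?thesis
    using assms by (simp add: measure_def N.emeasure_pair_measure_Times enn2real_mult)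
qed

text \<open>
  Replacing \<open>u\<close> by \<open>frac u\<close> only affects the null event \<open>u = 1\<close>, but makes
  \<open>\<lfloor>real N * fst z\<rfloor>\<close> the exact integer part of \<open>N\<close> times the new first coordinate.
\<close>

definition grid_smooth :: "nat \<Rightarrow> (real \<times> real) measure \<Rightarrow> (real \<times> real) measure" where
  "grid_smooth N M = distr (M \<Otimes>\<^sub>M uniform01) borel
     (\<lambda>(z, u). ((real_of_int \<lfloor>real N * fst z\<rfloor> + frac u) / real N, snd z))"

context
  fixes N :: nat and M :: "(real \<times> real) measure"
  assumes N: "0 < N" and M: "copula_measure M"
begin

private lemmas prob_M = copula_measure_prob_space[OF M]
  and sets_M [measurable_cong] = copula_measure_sets[OF M]

private lemma grid_map_measurable [measurable]:
  "(\<lambda>(z, u). ((real_of_int \<lfloor>real N * fst z\<rfloor> + frac u) / real N, snd z))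
     \<in> measurable (M \<Otimes>\<^sub>M uniform01) borel"
  by (simp add: borel_prod[symmetric]) 

text \<open>A point from a cell before that of \<open>x\<close> always counts, and one from the cell
  of \<open>x\<close> counts with independent probability \<open>frac (real N * x)\<close>. Keeping
  \<open>F\<close> general covers both the distribution function and the first marginal.\<close>

lemma measure_grid_smooth:
  assumes F: "F \<in> sets borel"
  shows "measure (grid_smooth N M) ({..x} \<times> F)
    = measure M ({s. \<lfloor>real N * s\<rfloor> < \<lfloor>real N * x\<rfloor>} \<times> F)
      + measure M ({s. \<lfloor>real N * s\<rfloor> = \<lfloor>real N * x\<rfloor>} \<times> F) * frac (real N * x)"
proof -
  interpret M: prob_space M by (rule prob_M)
  interpret U: prob_space uniform01 by (rule prob_space_uniform01)
  interpret P: pair_prob_space M uniform01 ..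
  let ?k = "\<lfloor>real N * x\<rfloor>" and ?t = "frac (real N * x)"
  let ?L = "{s. \<lfloor>real N * s\<rfloor> < ?k} \<times> F" and ?E = "{s. \<lfloor>real N * s\<rfloor> = ?k} \<times> F"
  \<comment> \<open>The summand 0 makes this an instance of
    \<open>measure_uniform01_frac_le\<close>.\<close>
  let ?V = "{u. frac (u + 0) \<le> ?t}"
  have spM: "space M = UNIV"
    using sets_eq_imp_space_eq[OF sets_M] by simp
  have m: "?L \<in> sets M" "?E \<in> sets M"
    using F by (auto simp: sets_M intro!: borel_Times)
  have mV: "?V \<in> sets uniform01" by simp
  have key: "(real_of_int \<lfloor>real N * s\<rfloor> + frac u) / real N \<le> x
      \<longleftrightarrow> \<lfloor>real N * s\<rfloor> < ?k \<or> \<lfloor>real N * s\<rfloor> = ?k \<and> frac u \<le> ?t" for s u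
  proof -
    have eq: "(real_of_int \<lfloor>real N * s\<rfloor> + frac u) / real N \<le> x
      \<longleftrightarrow> real_of_int \<lfloor>real N * s\<rfloor> + frac u \<le> real_of_int ?k + ?t"
      using N by (simp add: field_simps frac_def)
    have fr: "0 \<le> frac u" "frac u < 1" "0 \<le> ?t" "?t < 1" by (simp_all add: frac_lt_1)
    consider "\<lfloor>real N * s\<rfloor> \<le> ?k - 1" | "\<lfloor>real N * s\<rfloor> = ?k" | "?k + 1 \<le> \<lfloor>real N * s\<rfloor>"
      by linarith
    then show ?thesis
    proof cases
      case 1
      then have "real_of_int \<lfloor>real N * s\<rfloor> \<le> real_of_int ?k - 1" by linarith
      then show ?thesis using eq fr 1 by auto
    next
      case 3
      then have "real_of_int \<lfloor>real N * s\<rfloor> \<ge> real_of_int ?k + 1" by linarith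
      then show ?thesis using eq fr 3 by auto
    qed (use eq in auto)
  qed
  have "measure (grid_smooth N M) ({..x} \<times> F)
      = measure (M \<Otimes>\<^sub>M uniform01) (?L \<times> UNIV \<union> ?E \<times> ?V)"
    unfolding grid_smooth_def using F
    by (subst measure_distr[OF grid_map_measurable])
       (auto intro!: borel_Times arg_cong2[where f = measure] simp: key spM space_pair_measure)
  also have "\<dots> = measure (M \<Otimes>\<^sub>M uniform01) (?L \<times> UNIV) + measure (M \<Otimes>\<^sub>M uniform01) (?E \<times> ?V)"
    using m mV by (intro P.finite_measure_Union) auto
  also have "\<dots> = measure M ?L * measure uniform01 UNIV + measure M ?E * measure uniform01 ?V"
    using m mV by (simp add: measure_pair_Times[OF prob_M prob_space_uniform01])
  also have "measure uniform01 ?V = ?t"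
    by (rule measure_uniform01_frac_le) (auto simp: frac_lt_1 less_imp_le)
  also have "measure uniform01 UNIV = 1" using U.prob_space by simp
  finally show ?thesis by simp
qed

lemma measure_uniform01_cell: "measure uniform01 {s. \<lfloor>real N * s\<rfloor> = k} \<le> 1 / real N"
proof -
  have "{s. \<lfloor>real N * s\<rfloor> = k} \<subseteq> {of_int k / real N .. (of_int k + 1) / real N}"
    using N by (auto simp: field_simps floor_eq_iff)
  then have "measure uniform01 {s. \<lfloor>real N * s\<rfloor> = k} \<le> (of_int k + 1) / real N - of_int k / real N"
    by (intro measure_uniform01_le) (use N in \<open>auto simp: divide_right_mono\<close>)
  then show ?thesis by (simp add: add_divide_distrib)
qed

text \<open>The second coordinate is carried over. For the first, the cells before \<open>x\<close>
  contribute \<open>?k / N\<close> and the cell of \<open>x\<close> contributes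
  \<open>?t / N\<close>, which add up to \<open>x\<close>.\<close>

lemma copula_measure_grid_smooth: "copula_measure (grid_smooth N M)"
proof -
  interpret M: prob_space M by (rule prob_M)
  interpret U: prob_space uniform01 by (rule prob_space_uniform01)
  interpret P: pair_prob_space M uniform01 ..
  have pr: "prob_space (grid_smooth N M)"
    unfolding grid_smooth_def by (rule P.prob_space_distr) simp
  have sp: "sets (grid_smooth N M) = sets borel" by (simp add: grid_smooth_def)
  have "distr (grid_smooth N M) borel snd = distr (distr (M \<Otimes>\<^sub>M uniform01) M fst) borel snd"
    unfolding grid_smooth_def
    by (subst (1 2) distr_distr) (auto simp: comp_def split_def)
  also have "\<dots> = distr M borel snd"
    by (simp add: U.distr_pair_fst P.emeasure_space_1)
  also have "\<dots> = uniform01"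
    using M by (simp add: copula_measure_def uniform_marginals_def)
  finally have 2: "distr (grid_smooth N M) borel snd = uniform01" .
  have 1: "distr (grid_smooth N M) borel fst = uniform01"
  proof (rule uniform01_eqI)
    show "prob_space (distr (grid_smooth N M) borel fst)"
      by (rule prob_space.prob_space_distr[OF pr]) (simp cong: measurable_cong_sets add: sp)
    fix x :: real assume x: "0 \<le> x" "x \<le> 1"
    let ?k = "\<lfloor>real N * x\<rfloor>" and ?t = "frac (real N * x)"
    have "real N * x \<le> real N" using x by (simp add: mult_left_le)
    then have k: "0 \<le> ?k" "?k \<le> int N" using x by (simp_all add: floor_le_iff)
    have "measure (distr (grid_smooth N M) borel fst) {..x} = measure (grid_smooth N M) ({..x} \<times> UNIV)"
      by (subst measure_distr)
         (auto cong: measurable_cong_sets simp: sp sets_eq_imp_space_eq[OF sp] intro!: arg_cong2[where f = measure])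
    also have "\<dots> = measure uniform01 {s. \<lfloor>real N * s\<rfloor> < ?k} + measure uniform01 {s. \<lfloor>real N * s\<rfloor> = ?k} * ?t"
      by (simp add: measure_grid_smooth copula_measure_strip[OF M])
    also have "measure uniform01 {s. \<lfloor>real N * s\<rfloor> < ?k} = of_int ?k / real N"
    proof -
      have "{0..1} \<inter> {s. \<lfloor>real N * s\<rfloor> < ?k} = {0..<of_int ?k / real N}"
      proof -
        have "s \<le> 1" if "s < of_int ?k / real N" for s
        proof -
          have "of_int ?k / real N \<le> 1" using k N by simp
          then show ?thesis using that by linarith
        qed
        then show ?thesis using N by (auto simp: floor_less_iff field_simps)
      qed
      then show ?thesis using k by (simp add: measure_uniform01)
    qed
    also have "measure uniform01 {s. \<lfloor>real N * s\<rfloor> = ?k} * ?t = ?t / real N"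
    \<comment> \<open>This happens only at \<open>x = 1\<close>, whose cell meets the unit interval
      in a single point and so lacks the mass \<open>1 / N\<close>; there the factor
      \<open>?t\<close> vanishes.\<close>
    proof (cases "?k = int N")
      case True
      then have "?t = 0" using \<open>real N * x \<le> real N\<close> by (auto simp: floor_eq_iff frac_def)
      then show ?thesis by (simp only:)
    next
      case False
      have "{0..1} \<inter> {s. \<lfloor>real N * s\<rfloor> = ?k} = {of_int ?k / real N ..< (of_int ?k + 1) / real N}"
      proof -
        have "s \<le> 1" if "s < (of_int ?k + 1) / real N" for s
        proof -
          have "?k + 1 \<le> int N" using k False by linarith
          then have "(of_int ?k + 1) / real N \<le> 1" using N by simp
          then show ?thesis using that by linarith
        qed
        moreover have "0 \<le> s" if "of_int ?k / real N \<le> s" for s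
          using that k by (meson divide_nonneg_nonneg of_int_0_le_iff of_nat_0_le_iff order_trans)
        ultimately show ?thesis using N by (auto simp: floor_eq_iff field_simps)
      qed
      then have "measure uniform01 {s. \<lfloor>real N * s\<rfloor> = ?k} = 1 / real N"
        by (simp add: measure_uniform01 divide_right_mono add_divide_distrib)
      then show ?thesis by simp
    qed
    also have "of_int ?k / real N + ?t / real N = x"
      using N by (simp add: frac_def field_simps)
    finally show "measure (distr (grid_smooth N M) borel fst) {..x} = x" .
  qed simp
  show ?thesis using pr sp 1 2 by (simp add: copula_measure_def uniform_marginals_def)
qed

text \<open>Both values lie between the mass of \<open>?L\<close> and that of \<open>?L\<close> plus
  \<open>?E\<close>, and \<open>?E\<close> lies in a strip one cell wide.\<close>

lemma grid_smooth_close: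
  "\<bar>bivariate_cdf (grid_smooth N M) z - bivariate_cdf M z\<bar> \<le> 1 / real N"
proof (cases z)
  case (Pair x y)
  interpret M: prob_space M by (rule prob_M)
  let ?k = "\<lfloor>real N * x\<rfloor>" and ?t = "frac (real N * x)"
  let ?L = "{s. \<lfloor>real N * s\<rfloor> < ?k} \<times> {..y}" and ?E = "{s. \<lfloor>real N * s\<rfloor> = ?k} \<times> {..y}"
  have m: "?L \<in> sets M" "?E \<in> sets M" "{..x} \<times> {..y} \<in> sets M"
    "{s. \<lfloor>real N * s\<rfloor> = ?k} \<times> UNIV \<in> sets M"
    by (auto simp: sets_M intro!: borel_Times)
  have "?L \<subseteq> {..x} \<times> {..y}"
  proof -
    have "s \<le> x" if "\<lfloor>real N * s\<rfloor> < ?k" for s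
      using floor_less_cancel[OF that] N by simp
    then show ?thesis by auto
  qed
  moreover have "{..x} \<times> {..y} \<subseteq> ?L \<union> ?E"
  proof -
    have "\<lfloor>real N * s\<rfloor> < ?k \<or> \<lfloor>real N * s\<rfloor> = ?k" if "s \<le> x" for s
      using floor_mono[of "real N * s" "real N * x"] that by (auto simp: mult_left_mono)
    then show ?thesis by auto
  qed
  ultimately have "measure M ?L \<le> measure M ({..x} \<times> {..y})"
    "measure M ({..x} \<times> {..y}) \<le> measure M ?L + measure M ?E"
    using m M.finite_measure_mono[of ?L "{..x} \<times> {..y}"]
      M.finite_measure_mono[of "{..x} \<times> {..y}" "?L \<union> ?E"]
      measure_Un_le[of ?L M ?E] by auto
  moreover have "measure M ?E \<le> 1 / real N"
  proof -
    have "measure M ?E \<le> measure M ({s. \<lfloor>real N * s\<rfloor> = ?k} \<times> UNIV)"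
      using m by (intro M.finite_measure_mono) auto
    also have "\<dots> \<le> 1 / real N"
      using measure_uniform01_cell by (simp add: copula_measure_strip[OF M])
    finally show ?thesis .
  qed
  moreover have "0 \<le> measure M ?E * ?t" "measure M ?E * ?t \<le> measure M ?E"
    using frac_lt_1[of "real N * x"] by (auto simp: mult_left_le)
  moreover have "bivariate_cdf (grid_smooth N M) z = measure M ?L + measure M ?E * ?t"
    by (simp add: bivariate_cdf_def Pair measure_grid_smooth)
  moreover have "bivariate_cdf M z = measure M ({..x} \<times> {..y})"
    by (simp add: bivariate_cdf_def Pair)
  ultimately show ?thesis by linarith
qed

text \<open>Between neighbouring grid points the function is affine in \<open>t\<close>, with slope
  \<open>?e * real N\<close>.\<close>

lemma grid_smooth_differentiable:
  assumes x: "real N * x \<notin> \<int>"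
  obtains D where "((\<lambda>t. bivariate_cdf (grid_smooth N M) (t, y)) has_real_derivative D) (at x)"
proof -
  let ?k = "\<lfloor>real N * x\<rfloor>"
  let ?I = "{of_int ?k / real N <..< (of_int ?k + 1) / real N}"
  let ?l = "measure M ({s. \<lfloor>real N * s\<rfloor> < ?k} \<times> {..y})"
  let ?e = "measure M ({s. \<lfloor>real N * s\<rfloor> = ?k} \<times> {..y})"
  have "of_int ?k < real N * x"
    using x by (metis Ints_of_int less_le of_int_floor_le)
  then have xI: "x \<in> ?I"
    using N floor_less_iff[of "real N * x" "?k + 1"] by (auto simp: field_simps)
  have eq: "?l + ?e * (real N * t - of_int ?k) = bivariate_cdf (grid_smooth N M) (t, y)"
    if "t \<in> ?I" for t
  proof -
    have "\<lfloor>real N * t\<rfloor> = ?k"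
      using that N by (auto simp: floor_eq_iff field_simps)
    then show ?thesis by (simp add: bivariate_cdf_def measure_grid_smooth frac_def)
  qed
  have "((\<lambda>t. ?l + ?e * (real N * t - of_int ?k)) has_real_derivative ?e * real N) (at x)"
    by (auto intro!: derivative_eq_intros)
  then have "((\<lambda>t. bivariate_cdf (grid_smooth N M) (t, y)) has_real_derivative ?e * real N) (at x)"
    by (rule has_field_derivative_transform_within_open[where S = ?I]) (use xI eq in auto)
  then show thesis by (rule that)
qed

end

subsection \<open>A mixture of rotations\<close>

text \<open>Its copula is a shuffle of the comonotone copula \<open>min x y\<close>: the mass sits
  on segments of slope 1.\<close>

definition rotation :: "real \<Rightarrow> (real \<times> real) measure" where
  "rotation a = distr uniform01 borel (\<lambda>s. (s, frac (s + a)))"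

lemma
  shows copula_measure_rotation: "copula_measure (rotation a)"
    and bivariate_cdf_rotation: "bivariate_cdf (rotation a) (x, y) = measure uniform01 {s. s \<le> x \<and> frac (s + a) \<le> y}"
proof -
  have m [measurable]: "(\<lambda>s. (s, frac (s + a))) \<in> measurable uniform01 borel"
    by (simp add: borel_prod[symmetric]) 
  interpret prob_space uniform01 by (rule prob_space_uniform01)
  have "distr uniform01 borel (\<lambda>s. s) = uniform01"
    by (intro distr_id2) auto
  moreover have "distr uniform01 borel (\<lambda>s. frac (s + a)) = uniform01"
  proof (rule uniform01_eqI)
    show "prob_space (distr uniform01 borel (\<lambda>s. frac (s + a)))" by (rule prob_space_distr) simp
    fix y :: real assume "0 \<le> y" "y \<le> 1"
    then show "measure (distr uniform01 borel (\<lambda>s. frac (s + a))) {..y} = y"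
      using measure_uniform01_frac_le[of y a] by (subst measure_distr) (auto simp: vimage_def)
  qed simp
  ultimately show "copula_measure (rotation a)"
    using prob_space_distr[OF m] unfolding rotation_def copula_measure_def uniform_marginals_def
    by (auto simp: distr_distr comp_def)
  show "bivariate_cdf (rotation a) (x, y) = measure uniform01 {s. s \<le> x \<and> frac (s + a) \<le> y}"
    unfolding rotation_def bivariate_cdf_def
    by (auto simp: measure_distr borel_Times vimage_def)
qed

lemma rotation_increment:
  assumes "u \<le> v"
  shows "bivariate_cdf (rotation a) (v, y) - bivariate_cdf (rotation a) (u, y)
    = measure uniform01 {s. u < s \<and> s \<le> v \<and> frac (s + a) \<le> y}"
proof -
  interpret prob_space uniform01 by (rule prob_space_uniform01)
  have "{s. s \<le> v \<and> frac (s + a) \<le> y}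
      = {s. s \<le> u \<and> frac (s + a) \<le> y} \<union> {s. u < s \<and> s \<le> v \<and> frac (s + a) \<le> y}"
    using assms by auto
  then have "measure uniform01 {s. s \<le> v \<and> frac (s + a) \<le> y}
      = measure uniform01 {s. s \<le> u \<and> frac (s + a) \<le> y}
        + measure uniform01 {s. u < s \<and> s \<le> v \<and> frac (s + a) \<le> y}"
    by (simp only:) (intro finite_measure_Union; auto)
  then show ?thesis by (simp add: bivariate_cdf_rotation)
qed

text \<open>Monotonicity and Lipschitz constant 1 hold uniformly in \<open>a\<close>; this later
  supplies the dominating function.\<close>

lemma rotation_increment_bounds:
  assumes "u \<le> v"
  shows "0 \<le> bivariate_cdf (rotation a) (v, y) - bivariate_cdf (rotation a) (u, y)"
    and "bivariate_cdf (rotation a) (v, y) - bivariate_cdf (rotation a) (u, y) \<le> v - u"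
proof -
  let ?S = "{s. u < s \<and> s \<le> v \<and> frac (s + a) \<le> y}"
  show "0 \<le> bivariate_cdf (rotation a) (v, y) - bivariate_cdf (rotation a) (u, y)"
    unfolding rotation_increment[OF assms] by (rule measure_nonneg)
  have "?S \<in> sets borel" by measurable
  moreover have "?S \<subseteq> {u..v}" by auto
  ultimately show "bivariate_cdf (rotation a) (v, y) - bivariate_cdf (rotation a) (u, y) \<le> v - u"
    unfolding rotation_increment[OF assms] by (rule measure_uniform01_le[OF _ _ assms])
qed

text \<open>While the integer part of \<open>s + a\<close> stays \<open>n\<close>, the condition
  \<open>frac (s + a) \<le> y\<close> reads \<open>s \<le> y - a + n\<close>. Hence in the first
  argument the function is locally a minimum with a constant, up to an additive constant, with a
  single possible kink.\<close>

lemma rotation_increment_local: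
  assumes uv: "u \<le> v" "{u..v} \<subseteq> {0..1}" and fl: "\<And>s. s \<in> {u..v} \<Longrightarrow> \<lfloor>s + a\<rfloor> = n"
  shows "bivariate_cdf (rotation a) (v, y) - bivariate_cdf (rotation a) (u, y)
    = min v (y - a + of_int n) - min u (y - a + of_int n)"
proof -
  let ?c = "y - a + of_int n"
  have "{0..1} \<inter> {s. u < s \<and> s \<le> v \<and> frac (s + a) \<le> y} = {u<..min v ?c}"
    using uv by (auto simp: frac_def fl algebra_simps)
  then have "measure uniform01 {s. u < s \<and> s \<le> v \<and> frac (s + a) \<le> y} = measure lborel {u<..min v ?c}"
    by (simp add: measure_uniform01)
  also have "\<dots> = min v ?c - min u ?c"
    using uv by (cases "u \<le> ?c") auto
  finally show ?thesis using rotation_increment[OF uv(1)] by simp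
qed

section \<open>Symmetric second differences as a test for kinks\<close>

definition second_diff :: "(real \<Rightarrow> real) \<Rightarrow> real \<Rightarrow> real \<Rightarrow> real" where
  "second_diff g x h = (g (x + h) + g (x - h) - 2 * g x) / h"

text \<open>The second difference is the forward quotient minus the backward one, and both tend to
  \<open>D\<close>. At a kink its limit is the jump of the one-sided slopes.\<close>

lemma second_diff_tendsto_0:
  assumes g: "(g has_real_derivative D) (at x)"
  shows "(second_diff g x \<longlongrightarrow> 0) (at_right 0)"
proof -
  have 1: "((\<lambda>h. (g (x + h) - g x) / h) \<longlongrightarrow> D) (at 0)"
    using g by (simp add: has_field_derivative_def DERIV_def[symmetric] DERIV_D)
  have "filterlim (\<lambda>h::real. - h) (at 0) (at 0)"
    by (auto simp: filterlim_at intro!: tendsto_eq_intros eventually_at_filter[THEN iffD2])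
  then have 2: "((\<lambda>h. (g (x + - h) - g x) / - h) \<longlongrightarrow> D) (at 0)"
    by (rule filterlim_compose[OF 1])
  have "((\<lambda>h. (g (x + h) - g x) / h - (g (x + - h) - g x) / - h) \<longlongrightarrow> D - D) (at 0)"
    by (intro tendsto_diff 1 2)
  then have "((\<lambda>h. (g (x + h) - g x) / h - (g (x + - h) - g x) / - h) \<longlongrightarrow> 0) (at_right 0)"
    by (auto intro: filterlim_mono at_le)
  then show ?thesis
    by (rule Lim_transform_eventually)
       (auto simp: second_diff_def eventually_at_filter field_simps)
qed

text \<open>The two increments around \<open>x\<close> both lie between 0 and \<open>h\<close>, so
  their difference is at most \<open>h\<close> in modulus.\<close>

lemma second_diff_rotation_bound:
  assumes "0 < h"
  shows "\<bar>second_diff (\<lambda>t. bivariate_cdf (rotation a) (t, y)) x h\<bar> \<le> 1"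
  using rotation_increment_bounds[of x "x + h" a y] rotation_increment_bounds[of "x - h" x a y] assms
  by (auto simp: second_diff_def abs_le_iff field_simps)

text \<open>Near \<open>x\<close> the function is a minimum with \<open>?c\<close> up to a constant.
  If \<open>?c = x\<close>, the slope drops from 1 to 0 there; otherwise the function is affine
  close to \<open>x\<close>.\<close>

lemma second_diff_rotation_eventually:
  assumes x: "0 < x" "x < 1" "x + a \<notin> \<int>"
  shows "\<forall>\<^sub>F h in at_right 0. second_diff (\<lambda>t. bivariate_cdf (rotation a) (t, y)) x h
    = - indicator {a. frac (x + a) = y} a"
proof -
  let ?n = "\<lfloor>x + a\<rfloor>"
  let ?c = "y - a + of_int ?n"
  \<comment> \<open>A kink away from \<open>x\<close> must stay outside the window of radius
    \<open>h\<close>; for a kink at \<open>x\<close> any positive value serves. The other terms of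
    \<open>e\<close> keep the window inside the unit interval and the integer part of
    \<open>s + a\<close> constant on it.\<close>
  define d where "d = (if ?c = x then 1 else \<bar>?c - x\<bar>)"
  define e where "e = Min {x, 1 - x, frac (x + a), 1 - frac (x + a), d}"
  have "0 < frac (x + a)" using x(3) by simp
  moreover have "0 < d" by (simp add: d_def)
  ultimately have "0 < e" using x by (simp add: e_def frac_lt_1)
  then have "\<forall>\<^sub>F h in at_right 0. 0 < h \<and> h < e"
    by (auto simp: eventually_at_right)
  then show ?thesis
  proof eventually_elim
    case (elim h)
    then have h: "0 < h" "h < x" "h < 1 - x" "h < frac (x + a)" "h < 1 - frac (x + a)" "h < d"
      by (simp_all add: e_def)
    have fl: "\<lfloor>s + a\<rfloor> = ?n" if "s \<in> {x - h..x + h}" for s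
      using that h by (simp add: floor_eq_iff frac_def)
    have "bivariate_cdf (rotation a) (x + h, y) - bivariate_cdf (rotation a) (x, y)
        = min (x + h) ?c - min x ?c"
      using h by (intro rotation_increment_local fl) auto
    moreover have "bivariate_cdf (rotation a) (x, y) - bivariate_cdf (rotation a) (x - h, y)
        = min x ?c - min (x - h) ?c"
      using h by (intro rotation_increment_local fl) auto
    moreover have "?c = x \<longleftrightarrow> frac (x + a) = y"
      by (auto simp: frac_def)
    ultimately show ?case
      using h unfolding second_diff_def d_def
      by (auto simp: indicator_def field_simps min_def split: if_splits)
  qed
qed

section \<open>Averaging rotations over all rational shifts\<close>

definition rational_shifts :: "real pmf" where
  "rational_shifts = map_pmf (\<lambda>n. of_rat (from_nat n)) (geometric_pmf (1/2))"

text \<open>The geometric law charges every natural number and \<open>from_nat\<close> is onto. Only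
  this support enters the argument, not the individual weights.\<close>

lemma set_rational_shifts: "set_pmf rational_shifts = \<rat>"
proof -
  have "range (\<lambda>n. of_rat (from_nat n) :: real) = of_rat ` range from_nat"
    by (rule image_image[symmetric])
  then show ?thesis
    by (simp add: rational_shifts_def set_pmf_geometric Rats_def)
qed

definition rotation_mix :: "(real \<times> real) measure" where
  "rotation_mix = measure_pmf rational_shifts \<bind> rotation"

lemma copula_measure_rotation_mix: "copula_measure rotation_mix"
  unfolding rotation_mix_def by (intro copula_measure_bind copula_measure_rotation)

lemma bivariate_cdf_rotation_mix:
  "bivariate_cdf rotation_mix z = (\<integral>a. bivariate_cdf (rotation a) z \<partial>measure_pmf rational_shifts)"
  unfolding rotation_mix_def by (intro copula_measure_bind copula_measure_rotation)

text \<open>Second differences are averaged over \<open>a\<close>, and dominated convergence gives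
  minus the mass of \<open>?J\<close> as their limit; this mass is positive because
  \<open>y - x\<close> is a charged shift in \<open>?J\<close>.\<close>

lemma rotation_mix_not_differentiable:
  assumes x: "0 < x" "x < 1" "x \<notin> \<rat>" and y: "0 < y" "y < 1" "y - x \<in> \<rat>"
  shows "\<not> ((\<lambda>t. bivariate_cdf rotation_mix (t, y)) has_real_derivative D) (at x)"
proof
  let ?g = "\<lambda>a t. bivariate_cdf (rotation a) (t, y)"
  let ?J = "{a. frac (x + a) = y}"
  assume D: "((\<lambda>t. bivariate_cdf rotation_mix (t, y)) has_real_derivative D) (at x)"
  \<comment> \<open>Dominated convergence is applied along a sequence of step sizes.\<close>
  define h where "h = (\<lambda>n. inverse (real (Suc n)))"
  have h0: "filterlim h (at_right 0) sequentially"
    unfolding h_def by (auto simp: filterlim_at simp del: of_nat_Suc intro: LIMSEQ_inverse_real_of_nat)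
  have hpos: "0 < h n" for n by (simp add: h_def)
  have int: "integrable (measure_pmf rational_shifts) (\<lambda>a. ?g a t)" for t
  proof (rule measure_pmf.integrable_const_bound[where B = 1])
    show "AE a in measure_pmf rational_shifts. norm (?g a t) \<le> 1"
      using copula_measure_rotation
      by (auto simp: copula_measure_def bivariate_cdf_def prob_space.prob_le_1)
  qed simp
  have "second_diff (\<lambda>t. bivariate_cdf rotation_mix (t, y)) x (h n)
      = (\<integral>a. second_diff (?g a) x (h n) \<partial>measure_pmf rational_shifts)" for n
    unfolding second_diff_def bivariate_cdf_rotation_mix
    using int by simp
  moreover have "(\<lambda>n. \<integral>a. second_diff (?g a) x (h n) \<partial>measure_pmf rational_shifts)
      \<longlonglongrightarrow> (\<integral>a. - indicator ?J a \<partial>measure_pmf rational_shifts)"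
  proof (rule integral_dominated_convergence[where w = "\<lambda>_. 1"])
    show "AE a in measure_pmf rational_shifts. (\<lambda>n. second_diff (?g a) x (h n)) \<longlonglongrightarrow> - indicator ?J a"
    proof (subst AE_measure_pmf_iff, intro ballI)
      fix a assume "a \<in> set_pmf rational_shifts"
      then have "a \<in> \<rat>" by (simp add: set_rational_shifts)
      \<comment> \<open>Otherwise \<open>x\<close> would be rational, as \<open>a\<close>
        is.\<close>
      then have "x + a \<notin> \<int>"
        using x(3) Rats_diff[of "x + a" a] Ints_subset_Rats by auto
      then have "\<forall>\<^sub>F t in at_right 0. second_diff (?g a) x t = - indicator ?J a"
        using x by (intro second_diff_rotation_eventually)
      then have "\<forall>\<^sub>F n in sequentially. second_diff (?g a) x (h n) = - indicator ?J a"
        using h0 by (rule eventually_compose_filterlim)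
      then show "(\<lambda>n. second_diff (?g a) x (h n)) \<longlonglongrightarrow> - indicator ?J a"
        by (rule tendsto_eventually)
    qed
    show "AE a in measure_pmf rational_shifts. norm (second_diff (?g a) x (h n)) \<le> 1" for n
      using second_diff_rotation_bound[OF hpos] by simp
  qed simp_all
  moreover have "(\<lambda>n. second_diff (\<lambda>t. bivariate_cdf rotation_mix (t, y)) x (h n)) \<longlonglongrightarrow> 0"
    by (rule filterlim_compose[OF second_diff_tendsto_0[OF D] h0])
  ultimately have "(\<integral>a. - indicator ?J a \<partial>measure_pmf rational_shifts) = (0 :: real)"
    by (simp only:) (rule LIMSEQ_unique)
  then have "measure (measure_pmf rational_shifts) ?J = 0" by simp
  moreover have "y - x \<in> ?J" using y by (simp add: frac_eq)
  ultimately show False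
    using y(3) by (auto simp: measure_pmf_zero_iff set_rational_shifts)
qed

text \<open>This set will be \<open>\<Lambda>\<close>. Its points are interior, so the derivative
  within the unit interval is two-sided, and irrational, so they avoid all grid points.\<close>

lemma emeasure_irrationals_unit: "emeasure lborel ({0<..<1} - \<rat> :: real set) = 1"
proof -
  have "countable (\<rat> :: real set)" by (rule countable_rat)
  then have "(\<rat> :: real set) \<in> null_sets lborel"
    by (rule countable_imp_null_set_lborel)
  then show ?thesis by (subst emeasure_Diff_null_set) auto
qed

text \<open>Translates of the rationals are dense, and a dense set cut down to an open set remains
  dense in it.\<close>

lemma rational_translate_dense:
  fixes x :: real
  shows "{0..1} \<subseteq> closure ({0<..<1} \<inter> {y. y - x \<in> \<rat>})"
proof -
  have "{y. y - x \<in> \<rat>} = (+) x ` \<rat>"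
    by (auto simp: image_iff algebra_simps intro!: bexI[of _ "_ - x"])
  then have "closure {y. y - x \<in> \<rat>} = UNIV"
    using Rats_closure_real by (simp add: closure_translation)
  then have "closure ({0<..<1} \<inter> {y. y - x \<in> \<rat>}) = closure {0<..<1::real}"
    by (intro closure_open_Int_superset) auto
  then show ?thesis by simp
qed

subsection \<open>Density\<close>

text \<open>A derivative of the mixture, together with that of the smoothed part, would yield one
  for \<open>rotation_mix\<close> by solving the mixture identity for it.\<close>

lemma mix_in_copulas_Q:
  assumes N: "0 < N" and M: "copula_measure M" and d: "0 < d" and L: "copula_measure L"
    and cdf: "\<And>z. bivariate_cdf L z = d * bivariate_cdf rotation_mix z + (1 - d) * bivariate_cdf (grid_smooth N M) z"
  shows "restrict (bivariate_cdf L) unit_square \<in> copulas_Q"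
proof -
  let ?C = "restrict (bivariate_cdf L) unit_square"
  have nd: "\<not> has_partial1 ?C D (x, y)"
    if x: "x \<in> {0<..<1} - \<rat>" and y: "y \<in> {0<..<1} \<inter> {y. y - x \<in> \<rat>}" for x y D
  proof
    assume "has_partial1 ?C D (x, y)"
    then have "((\<lambda>t. ?C (t, y)) has_real_derivative D) (at x)"
      using x by (simp add: has_partial1_def at_within_Icc_at)
    \<comment> \<open>The restriction is \<open>undefined\<close> off the square, so the two
      functions are compared on the open unit interval only.\<close>
    then have CD: "((\<lambda>t. bivariate_cdf L (t, y)) has_real_derivative D) (at x)"
      by (rule has_field_derivative_transform_within_open[where S = "{0<..<1}"])
         (use x y in \<open>auto simp: unit_square_def\<close>)
    have "real N * x \<notin> \<int>"
    proof
      assume "real N * x \<in> \<int>"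
      then have "real N * x / real N \<in> \<rat>"
        using Ints_subset_Rats by (intro Rats_divide) auto
      then show False using x N by simp
    qed
    then obtain E where "((\<lambda>t. bivariate_cdf (grid_smooth N M) (t, y)) has_real_derivative E) (at x)"
      using grid_smooth_differentiable[OF N M] by blast
    then have "((\<lambda>t. (bivariate_cdf L (t, y) - (1 - d) * bivariate_cdf (grid_smooth N M) (t, y)) / d)
        has_real_derivative (D - (1 - d) * E) / d) (at x)"
      using CD d by (auto intro!: derivative_eq_intros)
    then have "((\<lambda>t. bivariate_cdf rotation_mix (t, y)) has_real_derivative (D - (1 - d) * E) / d) (at x)"
      using d by (simp add: cdf)
    then show False using rotation_mix_not_differentiable x y by auto
  qed
  have "?C \<in> copulas" using L by (auto simp: copulas_eq)
  moreover have "({0<..<1} - \<rat> :: real set) \<in> sets borel"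
    using countable_rat by (intro sets.Diff) (auto intro: sets.countable)
  moreover have "\<exists>Q. Q \<subseteq> {0..1} \<and> {0..1} \<subseteq> closure Q \<and> (\<forall>y\<in>Q. \<nexists>D. has_partial1 ?C D (x, y))"
    if "x \<in> {0<..<1} - \<rat>" for x
    using nd[OF that] rational_translate_dense[of x]
    by (intro exI[of _ "{0<..<1} \<inter> {y. y - x \<in> \<rat>}"]) auto
  ultimately show ?thesis
    unfolding copulas_Q_def using emeasure_irrationals_unit
    by - (rule CollectI, rule conjI, assumption, rule exI[of _ "{0<..<1} - \<rat>"], intro conjI ballI,
      auto)
qed

text \<open>Smoothing moves the copula by less than \<open>r / 3\<close> and mixing by at most
  \<open>d \<le> r / 3\<close>. The total \<open>2 * (r / 3)\<close> leaves room for a strict bound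
  after the supremum.\<close>

lemma copulas_Q_approx:
  assumes C: "C \<in> copulas" and r: "0 < r"
  shows "\<exists>B\<in>copulas_Q. d_inf C B < r"
proof -
  obtain M where M: "copula_measure M" and CM: "C = restrict (bivariate_cdf M) unit_square"
    using C by (auto simp: copulas_eq)
  obtain n where n: "inverse (real (Suc n)) < r / 3"
    using reals_Archimedean[of "r / 3"] r by auto
  \<comment> \<open>The cap at 1 keeps \<open>d\<close> a mixing weight when \<open>r\<close> is
    large.\<close>
  define d where "d = min 1 (r / 3)"
  have d: "0 < d" "d \<le> 1" "d \<le> r / 3" using r by (auto simp: d_def)
  let ?A = "grid_smooth (Suc n) M"
  have A: "copula_measure ?A" using M by (intro copula_measure_grid_smooth) auto
  obtain L where L: "copula_measure L"
    and cdf: "\<And>z. bivariate_cdf L z = d * bivariate_cdf rotation_mix z + (1 - d) * bivariate_cdf ?A z"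
    using copula_measure_mix[OF copula_measure_rotation_mix A, of d] d by auto
  let ?B = "restrict (bivariate_cdf L) unit_square"
  have BQ: "?B \<in> copulas_Q"
    using M d L cdf by (intro mix_in_copulas_Q[of "Suc n" M d]) auto
  have "\<bar>C z - ?B z\<bar> \<le> 2 * (r / 3)" if z: "z \<in> unit_square" for z
  proof -
    have bnd: "0 \<le> bivariate_cdf P z \<and> bivariate_cdf P z \<le> 1" if "copula_measure P" for P
      using that by (cases z) (auto simp: copula_measure_def bivariate_cdf_def prob_space.prob_le_1)
    have "bivariate_cdf L z - bivariate_cdf ?A z = d * (bivariate_cdf rotation_mix z - bivariate_cdf ?A z)"
      by (simp add: cdf algebra_simps)
    moreover have "\<bar>bivariate_cdf rotation_mix z - bivariate_cdf ?A z\<bar> \<le> 1"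
      using bnd[OF A] bnd[OF copula_measure_rotation_mix] by auto
    ultimately have "\<bar>bivariate_cdf L z - bivariate_cdf ?A z\<bar> \<le> d"
      using d by (simp add: abs_mult mult_left_le)
    moreover have "\<bar>bivariate_cdf ?A z - bivariate_cdf M z\<bar> \<le> 1 / real (Suc n)"
      using M by (intro grid_smooth_close) auto
    ultimately show ?thesis
      using n d(3) z unfolding CM restrict_def inverse_eq_divide by (simp only: if_True)
  qed
  then have "d_inf C ?B \<le> 2 * (r / 3)"
    using C L by (intro d_inf_least) (auto simp: copulas_eq)
  then show ?thesis using BQ r by (intro bexI[of _ ?B]) auto
qed

theorem corollary3p4:
  shows "Metric_space.mtopology copulas d_inf closure_of copulas_Q = copulas"
proof -
  interpret Metric_space copulas d_inf by (rule Metric_space_copulas)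
  have "copulas_Q \<subseteq> copulas" by (auto simp: copulas_Q_def)
  then show ?thesis
    using copulas_Q_approx by (fastforce simp: metric_closure_of in_mball)
qed

end
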